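(* Let $F_1,F_2,P_1,P_2$ be holomorphic functions of $(v_1,v_2)$ on a domain in $\mathbb{C}^2$, and let $w_1,w_2$ be holomorphic functions of $(v_1,v_2)$ with nonvanishing Jacobian $\frac{\partial(w_1,w_2)}{\partial(v_1,v_2)}$ satisfying $$\{w_1,w_2;v_1,v_2\}_{v_1}=F_1,\quad \{w_1,w_2;v_1,v_2\}_{v_2}=F_2,\quad [w_1,w_2;v_1,v_2]_{v_1}=P_1,\quad [w_1,w_2;v_1,v_2]_{v_2}=P_2.$$ Let $\Delta=\frac{\partial(v_1,v_2)}{\partial(w_1,w_2)}=\frac{\partial v_1}{\partial w_1}\frac{\partial v_2}{\partial w_2}-\frac{\partial v_1}{\partial w_2}\frac{\partial v_2}{\partial w_1}$ (the Jacobian of the inverse map, regarded as a function of $(v_1,v_2)$), and let $z=\sqrt[3]{\Delta}$. Then $$\frac{\partial^2 z}{\partial v_1^2}+\frac13 P_1\frac{\partial z}{\partial v_1}-F_1\frac{\partial z}{\partial v_2}+\Big(\frac{\partial F_1}{\partial v_2}-\frac13\frac{\partial P_1}{\partial v_1}-\frac29P_1^2-\frac23F_1P_2\Big)z=0,$$ $$\frac{\partial^2 z}{\partial v_1\partial v_2}-\frac13 P_2\frac{\partial z}{\partial v_1}-\frac13 P_1\frac{\partial z}{\partial v_2}+\Big(\frac13\frac{\partial P_2}{\partial v_1}+\frac13\frac{\partial P_1}{\partial v_2}+\frac19P_1P_2-F_1F_2\Big)z=0,$$ $$\frac{\partial^2 z}{\partial v_2^2}+\frac13 P_2\frac{\partial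 z}{\partial v_2}-F_2\frac{\partial z}{\partial v_1}+\Big(\frac{\partial F_2}{\partial v_1}-\frac13\frac{\partial P_2}{\partial v_2}-\frac29P_2^2-\frac23F_2P_1\Big)z=0.$$
   Context: For holomorphic functions $u_1,u_2$ of two complex variables $(x,y)$, write $u_{i,x}=\partial u_i/\partial x$, $u_{i,xx}=\partial^2u_i/\partial x^2$, $u_{i,xy}=\partial^2u_i/\partial x\partial y$, etc., and $J=\frac{\partial(u_1,u_2)}{\partial(x,y)}=u_{1,x}u_{2,y}-u_{1,y}u_{2,x}$, assumed nonzero. Define $\{u_1,u_2;x,y\}_x=\frac{u_{1,x}u_{2,xx}-u_{2,x}u_{1,xx}}{J}$, $\{u_1,u_2;x,y\}_y=\frac{u_{1,y}u_{2,yy}-u_{2,y}u_{1,yy}}{-J}$, $[u_1,u_2;x,y]_x=\frac{(u_{1,y}u_{2,xx}-u_{2,y}u_{1,xx})+2(u_{1,x}u_{2,xy}-u_{2,x}u_{1,xy})}{J}$, $[u_1,u_2;x,y]_y=\frac{(u_{1,x}u_{2,yy}-u_{2,x}u_{1,yy})+2(u_{1,y}u_{2,xy}-u_{2,y}u_{1,xy})}{-J}$. *)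

theory Defs
  imports "HOL-Complex_Analysis.Complex_Analysis"
begin

text \<open>
  Functions of two complex variables are functions on \<^typ>\<open>complex \<times> complex\<close>.
  Holomorphy is complex Frechet differentiability: the real derivative exists and is
  complex linear.
\<close>

definition holomorphic2_on :: "(complex \<times> complex \<Rightarrow> complex) \<Rightarrow> (complex \<times> complex) set \<Rightarrow> bool"
    (infixl "holomorphic2'_on" 50)
  where "f holomorphic2_on S \<longleftrightarrow>
    (\<forall>p\<in>S. \<exists>a b. (f has_derivative (\<lambda>h. a * fst h + b * snd h)) (at p within S))"

definition pd1 :: "(complex \<times> complex \<Rightarrow> complex) \<Rightarrow> complex \<times> complex \<Rightarrow> complex"
  where "pd1 f p = deriv (\<lambda>t. f (t, snd p)) (fst p)"

definition pd2 :: "(complex \<times> complex \<Rightarrow> complex) \<Rightarrow> complex \<times> complex \<Rightarrow> complex"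
  where "pd2 f p = deriv (\<lambda>t. f (fst p, t)) (snd p)"

definition jacobian_det ::
    "(complex \<times> complex \<Rightarrow> complex) \<Rightarrow> (complex \<times> complex \<Rightarrow> complex) \<Rightarrow> complex \<times> complex \<Rightarrow> complex"
  where "jacobian_det u1 u2 p = pd1 u1 p * pd2 u2 p - pd2 u1 p * pd1 u2 p"

text \<open>
  The differential expressions \<open>{u1,u2;x,y}\<^sub>x\<close>, \<open>{u1,u2;x,y}\<^sub>y\<close>, \<open>[u1,u2;x,y]\<^sub>x\<close>,
  \<open>[u1,u2;x,y]\<^sub>y\<close>, in this order; \<open>x\<close> and \<open>y\<close> are the first and second coordinate.
\<close>

definition brace_x ::
    "(complex \<times> complex \<Rightarrow> complex) \<Rightarrow> (complex \<times> complex \<Rightarrow> complex) \<Rightarrow> complex \<times> complex \<Rightarrow> complex"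
  where "brace_x u1 u2 p =
    (pd1 u1 p * pd1 (pd1 u2) p - pd1 u2 p * pd1 (pd1 u1) p) / jacobian_det u1 u2 p"

definition brace_y ::
    "(complex \<times> complex \<Rightarrow> complex) \<Rightarrow> (complex \<times> complex \<Rightarrow> complex) \<Rightarrow> complex \<times> complex \<Rightarrow> complex"
  where "brace_y u1 u2 p =
    (pd2 u1 p * pd2 (pd2 u2) p - pd2 u2 p * pd2 (pd2 u1) p) / (- jacobian_det u1 u2 p)"

definition bracket_x ::
    "(complex \<times> complex \<Rightarrow> complex) \<Rightarrow> (complex \<times> complex \<Rightarrow> complex) \<Rightarrow> complex \<times> complex \<Rightarrow> complex"
  where "bracket_x u1 u2 p =
    ((pd2 u1 p * pd1 (pd1 u2) p - pd2 u2 p * pd1 (pd1 u1) p)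
      + 2 * (pd1 u1 p * pd1 (pd2 u2) p - pd1 u2 p * pd1 (pd2 u1) p)) / jacobian_det u1 u2 p"

definition bracket_y ::
    "(complex \<times> complex \<Rightarrow> complex) \<Rightarrow> (complex \<times> complex \<Rightarrow> complex) \<Rightarrow> complex \<times> complex \<Rightarrow> complex"
  where "bracket_y u1 u2 p =
    ((pd1 u1 p * pd2 (pd2 u2) p - pd1 u2 p * pd2 (pd2 u1) p)
      + 2 * (pd2 u1 p * pd1 (pd2 u2) p - pd2 u2 p * pd1 (pd2 u1) p)) / (- jacobian_det u1 u2 p)"

text \<open>
  \<open>(v1, v2)\<close> is a holomorphic inverse, on the open image of the open set \<open>U\<close>, of the
  holomorphic map \<open>(w1, w2)\<close> on \<open>U\<close>.
\<close>

definition holomorphic_inverse_on ::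
    "(complex \<times> complex) set \<Rightarrow>
     (complex \<times> complex \<Rightarrow> complex) \<Rightarrow> (complex \<times> complex \<Rightarrow> complex) \<Rightarrow>
     (complex \<times> complex \<Rightarrow> complex) \<Rightarrow> (complex \<times> complex \<Rightarrow> complex) \<Rightarrow> bool"
  where "holomorphic_inverse_on U w1 w2 v1 v2 \<longleftrightarrow>
    open U \<and> w1 holomorphic2_on U \<and> w2 holomorphic2_on U \<and>
    open ((\<lambda>q. (w1 q, w2 q)) ` U) \<and>
    v1 holomorphic2_on ((\<lambda>q. (w1 q, w2 q)) ` U) \<and>
    v2 holomorphic2_on ((\<lambda>q. (w1 q, w2 q)) ` U) \<and>
    (\<forall>q\<in>U. (v1 (w1 q, w2 q), v2 (w1 q, w2 q)) = q)"

text \<open>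
  The Jacobian of the inverse of \<open>(w1, w2)\<close>, as a function of the point \<open>p\<close> in the source
  of \<open>(w1, w2)\<close>.  A map with nonvanishing Jacobian need not be injective, so the inverse is
  the local one near \<open>p\<close>; it exists by the inverse function theorem and its Jacobian at
  \<open>(w1 p, w2 p)\<close> does not depend on the choice of \<open>U\<close>.
\<close>

definition inverse_jacobian ::
    "(complex \<times> complex \<Rightarrow> complex) \<Rightarrow> (complex \<times> complex \<Rightarrow> complex) \<Rightarrow> complex \<times> complex \<Rightarrow> complex"
  where "inverse_jacobian w1 w2 p =
    (THE d. \<exists>U v1 v2. p \<in> U \<and> holomorphic_inverse_on U w1 w2 v1 v2 \<and>
                      d = jacobian_det v1 v2 (w1 p, w2 p))"

end

theory Submission
  imports Defs
begin

text \<open>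
  The nonvanishing Jacobian \<open>J\<close> lets one express the second derivatives of \<open>w1\<close> and \<open>w2\<close> by the
  first ones: both are solutions of a system
  \<open>u\<^sub>x\<^sub>x = A u\<^sub>x + B u\<^sub>y\<close>, \<open>u\<^sub>x\<^sub>y = C u\<^sub>x + E u\<^sub>y\<close>, \<open>u\<^sub>y\<^sub>y = G u\<^sub>x + H u\<^sub>y\<close>,
  and Cramer's rule gives \<open>F1 = B\<close>, \<open>F2 = G\<close>, \<open>P1 = 2E - A\<close>, \<open>P2 = 2C - H\<close>.  Comparing the two ways
  of computing \<open>u\<^sub>x\<^sub>x\<^sub>y\<close> and \<open>u\<^sub>x\<^sub>y\<^sub>y\<close> yields four integrability conditions for the coefficients.
  On the other hand \<open>J\<^sub>x = (A + E) J\<close> and \<open>J\<^sub>y = (C + H) J\<close>, so that a continuous cube root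
  \<open>z\<close> of \<open>1 / J\<close> satisfies \<open>z\<^sub>x = -(A + E) z / 3\<close> and \<open>z\<^sub>y = -(C + H) z / 3\<close>; differentiating once more and
  inserting the integrability conditions gives the three equations.
  The regularity needed (partial derivatives of holomorphic functions are holomorphic and commute)
  comes from Cauchy's integral formula in the first variable.
\<close>

subsection \<open>Osgood's lemma and partial derivatives\<close>

text \<open>The factor \<open>2 \<pi> \<i>\<close> of the derivative of the circle path is cancelled against the one in
  Cauchy's formula.\<close>

definition cauchy_kernel :: "complex \<Rightarrow> real \<Rightarrow> complex \<Rightarrow> real \<Rightarrow> complex"
  where "cauchy_kernel c r x t =
    of_real r * exp (2 * of_real pi * \<i> * of_real t) / (circlepath c r t - x)\<^sup>2"

lemma circlepath_in_sphere: "0 \<le> r \<Longrightarrow> 0 \<le> t \<Longrightarrow> t \<le> 1 \<Longrightarrow> circlepath c r t \<in> sphere c r"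
  using path_image_circlepath[where r = r and z = c] by (auto simp: path_image_def)

lemma continuous_on_cauchy_kernel:
  assumes "0 < r"
  shows "continuous_on (ball c r \<times> {0..1}) (\<lambda>(x, t). cauchy_kernel c r x t)"
proof -
  have "circlepath c r t \<noteq> x" if "x \<in> ball c r" "t \<in> {0..1}" for x t
    using circlepath_in_sphere[of r t c] that assms by auto
  moreover have "continuous_on S (\<lambda>p. circlepath c r (snd p))" for S :: "(complex \<times> real) set"
    unfolding circlepath by (intro continuous_intros)
  ultimately show ?thesis
    unfolding cauchy_kernel_def case_prod_beta
    by (intro continuous_intros) auto
qed

text \<open>The second variable enters this integral only as a parameter of the integrand.
  Continuity and differentiability in \<open>y\<close> can therefore be read off under the integral
  sign.\<close>

lemma has_pd1_cauchy:
  assumes cont: "continuous_on D f"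
    and diff: "\<And>p. p \<in> D \<Longrightarrow> (\<lambda>t. f (t, snd p)) field_differentiable at (fst p)"
    and sub: "cball c r \<times> {y} \<subseteq> D" and x: "x \<in> ball c r"
  shows "((\<lambda>t. f (t, y)) has_field_derivative
           integral {0..1} (\<lambda>t. f (circlepath c r t, y) * cauchy_kernel c r x t)) (at x)"
proof -
  have 1: "continuous_on (cball c r) (\<lambda>t. f (t, y))"
    using sub by (intro continuous_on_compose2[OF cont] continuous_intros) auto
  have 2: "(\<lambda>t. f (t, y)) holomorphic_on ball c r"
    unfolding holomorphic_on_def
  proof
    fix u assume "u \<in> ball c r"
    then have "(\<lambda>t. f (t, y)) field_differentiable at u"
      using sub diff[of "(u, y)"] by (auto simp: subset_iff)
    then show "(\<lambda>t. f (t, y)) field_differentiable at u within ball c r"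
      by (rule field_differentiable_at_within)
  qed
  note C = Cauchy_derivative_integral_circlepath(2)[OF 1 2 x]
  have "contour_integral (circlepath c r) (\<lambda>u. f (u, y) / (u - x)\<^sup>2) =
      integral {0..1} (\<lambda>t. (2 * of_real pi * \<i>) * (f (circlepath c r t, y) * cauchy_kernel c r x t))"
    unfolding contour_integral_integral vector_derivative_circlepath cauchy_kernel_def
    by (rule integral_cong) (simp only: times_divide_eq_left times_divide_eq_right
        of_real_mult of_real_numeral ac_simps)
  also have "\<dots> = (2 * of_real pi * \<i>) *
      integral {0..1} (\<lambda>t. f (circlepath c r t, y) * cauchy_kernel c r x t)"
    by (rule integral_mult_right)
  finally show ?thesis using C by simp
qed

lemma polydisc_in_open:
  assumes "open D" "(x, y) \<in> D"
  obtains r where "0 < r" "cball x r \<times> cball y r \<subseteq> (D :: (complex \<times> complex) set)"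
proof -
  obtain A B where AB: "open A" "open B" "x \<in> A" "y \<in> B" "A \<times> B \<subseteq> D"
    using open_prod_elim[OF assms] by (metis mem_Sigma_iff)
  obtain r s where "0 < r" "cball x r \<subseteq> A" "0 < s" "cball y s \<subseteq> B"
    using AB open_contains_cball by meson
  then have "0 < min r s" "cball x (min r s) \<times> cball y (min r s) \<subseteq> D"
    using AB(5) by fastforce+
  then show ?thesis using that by blast
qed

lemma continuous_on_cauchy_integrand:
  assumes "continuous_on D f" "0 < r" "cball c r \<times> V \<subseteq> D"
  shows "continuous_on ((ball c r \<times> V) \<times> {0..1})
           (\<lambda>(p, t). f (circlepath c r t, snd p) * cauchy_kernel c r (fst p) t)"
proof -
  have "continuous_on ((ball c r \<times> V) \<times> {0..1}) (\<lambda>q. f (circlepath c r (snd q), snd (fst q)))"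
  proof (intro continuous_on_compose2[OF assms(1)])
    show "continuous_on ((ball c r \<times> V) \<times> {0..1})
            (\<lambda>q. (circlepath c r (snd q), snd (fst q)))"
      unfolding circlepath by (intro continuous_intros)
    show "(\<lambda>q. (circlepath c r (snd q), snd (fst q))) ` ((ball c r \<times> V) \<times> {0..1}) \<subseteq> D"
      using assms circlepath_in_sphere[of r _ c] by (fastforce simp: subset_iff)
  qed
  moreover have "continuous_on ((ball c r \<times> V) \<times> {0..1})
      (\<lambda>q. cauchy_kernel c r (fst (fst q)) (snd q))"
    using continuous_on_compose[of "(ball c r \<times> V) \<times> {0..1}" "\<lambda>q. (fst (fst q), snd q)",
        OF _ continuous_on_subset[OF continuous_on_cauchy_kernel[OF assms(2), of c]]]
    by (force simp: case_prod_beta comp_def intro!: continuous_intros)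
  ultimately show ?thesis
    by (simp add: case_prod_beta continuous_on_mult)
qed

text \<open>On a small polydisc \<open>pd1 f\<close> is a Cauchy integral whose integrand is jointly
  continuous in the point and in the parameter of the circle. Integrating over the compact interval
  \<open>{0..1}\<close> preserves continuity.\<close>

lemma continuous_on_pd1:
  assumes "open D" and cont: "continuous_on D f"
    and diff: "\<And>p. p \<in> D \<Longrightarrow> (\<lambda>t. f (t, snd p)) field_differentiable at (fst p)"
  shows "continuous_on D (pd1 f)"
proof -
  have "isCont (pd1 f) (x, y)" if xy: "(x, y) \<in> D" for x y
  proof -
    obtain r where r: "0 < r" "cball x r \<times> cball y r \<subseteq> D"
      using polydisc_in_open[OF assms(1) xy] .
    let ?S = "ball x r \<times> ball y r"
    have "continuous_on (?S \<times> cbox 0 1)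
           (\<lambda>(p, t). f (circlepath x r t, snd p) * cauchy_kernel x r (fst p) t)"
      unfolding box_real
      by (rule continuous_on_cauchy_integrand[OF cont]) (use r in auto)
    from integral_continuous_on_param[OF this]
    have "continuous_on ?S
        (\<lambda>p. integral {0..1} (\<lambda>t. f (circlepath x r t, snd p) * cauchy_kernel x r (fst p) t))"
      by simp
    moreover have "integral {0..1} (\<lambda>t. f (circlepath x r t, snd p) * cauchy_kernel x r (fst p) t)
        = pd1 f p" if "p \<in> ?S" for p
      unfolding pd1_def
      by (rule DERIV_imp_deriv[symmetric], rule has_pd1_cauchy[OF cont diff]) (use that r in auto)
    ultimately have "continuous_on ?S (pd1 f)" by (simp cong: continuous_on_cong)
    then show ?thesis
      using r by (simp add: continuous_on_eq_continuous_at open_Times)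
  qed
  then show ?thesis by (simp add: continuous_at_imp_continuous_on split_paired_all)
qed

text \<open>Exchanging the coordinates carries results on \<open>pd1\<close> over to
  \<open>pd2\<close>, so Cauchy's formula is needed in the first variable only.\<close>

lemma pd1_swap: "pd1 (f \<circ> prod.swap) p = pd2 f (prod.swap p)"
  by (simp add: pd1_def pd2_def comp_def)

lemma continuous_on_swap: "continuous_on S prod.swap"
  unfolding prod.swap_def by (intro continuous_intros)

lemma open_swap: "open D \<Longrightarrow> open (prod.swap -` D)"
  by (intro open_vimage continuous_on_swap)

lemma continuous_on_pd2:
  assumes "open D" and cont: "continuous_on D f"
    and diff: "\<And>p. p \<in> D \<Longrightarrow> (\<lambda>t. f (fst p, t)) field_differentiable at (snd p)"
  shows "continuous_on D (pd2 f)"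
proof -
  have "continuous_on (prod.swap -` D) (pd1 (f \<circ> prod.swap))"
    using diff
    by (intro continuous_on_pd1 open_swap assms continuous_on_compose continuous_on_swap
        continuous_on_subset[OF cont]) (auto simp: comp_def)
  from continuous_on_compose2[OF this continuous_on_swap, of D]
  show ?thesis by (simp add: pd1_swap image_subset_iff)
qed

lemma
  assumes "f holomorphic2_on D" "open D" "p \<in> D"
  shows has_derivative_holomorphic2:
      "(f has_derivative (\<lambda>h. pd1 f p * fst h + pd2 f p * snd h)) (at p)"
    and has_pd1: "((\<lambda>t. f (t, snd p)) has_field_derivative pd1 f p) (at (fst p))"
    and has_pd2: "((\<lambda>t. f (fst p, t)) has_field_derivative pd2 f p) (at (snd p))"
proof -
  obtain a b where ab: "(f has_derivative (\<lambda>h. a * fst h + b * snd h)) (at p)"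
    using assms unfolding holomorphic2_on_def by (metis at_within_open)
  have "((\<lambda>t. f (t, snd p)) has_derivative (\<lambda>h. a * fst (h, 0::complex) + b * snd (h, 0::complex))) (at (fst p))"
    by (rule has_derivative_compose[of "\<lambda>t. (t, snd p)" "\<lambda>h. (h, 0)", unfolded fst_conv])
      (auto intro!: derivative_eq_intros ab)
  then have 1: "((\<lambda>t. f (t, snd p)) has_field_derivative a) (at (fst p))"
    by (simp add: has_field_derivative_def)
  have "((\<lambda>t. f (fst p, t)) has_derivative (\<lambda>h. a * fst (0::complex, h) + b * snd (0::complex, h))) (at (snd p))"
    by (rule has_derivative_compose[of "\<lambda>t. (fst p, t)" "\<lambda>h. (0, h)"])
      (auto intro!: derivative_eq_intros ab)
  then have 2: "((\<lambda>t. f (fst p, t)) has_field_derivative b) (at (snd p))"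
    by (simp add: has_field_derivative_def)
  have "a = pd1 f p" "b = pd2 f p"
    unfolding pd1_def pd2_def using 1 2 DERIV_imp_deriv by metis+
  then show "(f has_derivative (\<lambda>h. pd1 f p * fst h + pd2 f p * snd h)) (at p)"
    "((\<lambda>t. f (t, snd p)) has_field_derivative pd1 f p) (at (fst p))"
    "((\<lambda>t. f (fst p, t)) has_field_derivative pd2 f p) (at (snd p))"
    using ab 1 2 by auto
qed

lemma holomorphic2_on_imp_continuous_on: "f holomorphic2_on D \<Longrightarrow> continuous_on D f"
  unfolding holomorphic2_on_def continuous_on_eq_continuous_within
  using has_derivative_continuous by blast

text \<open>A function is totally differentiable at a point if one partial derivative exists there
  and the other exists nearby and is continuous. The continuity of \<open>pd2 f\<close> is supplied
  by Cauchy's formula, through \<open>continuous_on_pd2\<close>.\<close>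

lemma osgood:
  assumes "open D" and cont: "continuous_on D f"
    and diff1: "\<And>p. p \<in> D \<Longrightarrow> (\<lambda>t. f (t, snd p)) field_differentiable at (fst p)"
    and diff2: "\<And>p. p \<in> D \<Longrightarrow> (\<lambda>t. f (fst p, t)) field_differentiable at (snd p)"
  shows "f holomorphic2_on D"
  unfolding holomorphic2_on_def
proof
  fix p assume "p \<in> D"
  obtain x y where p: "p = (x, y)" by (cases p)
  obtain r where r: "0 < r" "cball x r \<times> cball y r \<subseteq> D"
    using polydisc_in_open \<open>p \<in> D\<close> assms(1) p by metis
  let ?X = "ball x r" and ?Y = "ball y r"
  have sub: "?X \<times> ?Y \<subseteq> D" using r by auto
  have c: "continuous_on (?X \<times> ?Y) (pd2 f)"
    using continuous_on_subset[OF continuous_on_pd2[OF assms(1) cont diff2] sub] .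
  have "((\<lambda>(x, y). f (x, y)) has_derivative
      (\<lambda>(tx, ty). pd1 f p * tx + blinfun_mult_right (pd2 f (x, y)) ty)) (at (x, y) within ?X \<times> ?Y)"
  proof (rule has_derivative_partialsI)
    have "((\<lambda>x. f (x, y)) has_field_derivative pd1 f p) (at x)"
      using diff1[OF \<open>p \<in> D\<close>] by (simp add: p pd1_def field_differentiable_derivI)
    then show "((\<lambda>x. f (x, y)) has_derivative (*) (pd1 f p)) (at x within ?X)"
      by (auto simp: has_field_derivative_def intro: has_derivative_at_withinI)
    show "((\<lambda>y. f (a, y)) has_derivative blinfun_mult_right (pd2 f (a, b))) (at b within ?Y)"
      if "a \<in> ?X" "b \<in> ?Y" for a b
    proof -
      have "((\<lambda>y. f (a, y)) has_field_derivative pd2 f (a, b)) (at b)"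
        using field_differentiable_derivI[OF diff2[of "(a, b)"]] that sub
        by (auto simp: pd2_def subset_iff)
      then show ?thesis
        by (auto simp: has_field_derivative_def intro: has_derivative_at_withinI)
    qed
    have "continuous_on (?X \<times> ?Y) (\<lambda>(a, b). blinfun_mult_right (pd2 f (a, b)))"
      unfolding case_prod_beta by (intro continuous_intros) (simp add: c)
    then show "continuous (at (x, y) within ?X \<times> ?Y) (\<lambda>(a, b). blinfun_mult_right (pd2 f (a, b)))"
      using r unfolding continuous_on_eq_continuous_within by auto
  qed (use r in auto)
  then have "(f has_derivative (\<lambda>h. pd1 f p * fst h + pd2 f p * snd h)) (at p)"
    using at_within_open[of "(x, y)" "?X \<times> ?Y"] r
    by (simp add: p case_prod_beta' open_Times)
  then show "\<exists>a b. (f has_derivative (\<lambda>h. a * fst h + b * snd h)) (at p within D)"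
    using has_derivative_at_withinI by blast
qed

lemma holomorphic2_on_swap:
  assumes "open D" "f holomorphic2_on D"
  shows "(f \<circ> prod.swap) holomorphic2_on (prod.swap -` D)"
proof (rule osgood)
  show "open (prod.swap -` D)" by (rule open_swap[OF assms(1)])
  show "continuous_on (prod.swap -` D) (f \<circ> prod.swap)"
    by (intro continuous_on_compose continuous_on_swap
        continuous_on_subset[OF holomorphic2_on_imp_continuous_on[OF assms(2)]]) auto
next
  fix p assume "p \<in> prod.swap -` D"
  then have "prod.swap p \<in> D" by simp
  note has_pd1[OF assms(2,1) this] has_pd2[OF assms(2,1) this]
  then show "(\<lambda>t. (f \<circ> prod.swap) (t, snd p)) field_differentiable at (fst p)"
    "(\<lambda>t. (f \<circ> prod.swap) (fst p, t)) field_differentiable at (snd p)"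
    by (auto simp: field_differentiable_def)
qed

section \<open>Holomorphy and symmetry of the partial derivatives\<close>

text \<open>Cauchy's formula for \<open>pd1 f\<close> is differentiated in the second variable under
  the integral sign. The kernel does not depend on that variable, so the result is the Cauchy
  integral of \<open>pd2 f\<close>.\<close>

lemma has_pd2_pd1_cauchy:
  fixes c d :: complex
  assumes D: "open D" and f: "f holomorphic2_on D"
    and r: "0 < r" "cball c r \<times> ball d r \<subseteq> D" "x \<in> ball c r" "y \<in> ball d r"
  shows "((\<lambda>s. pd1 f (x, s)) has_field_derivative
           integral {0..1} (\<lambda>t. pd2 f (circlepath c r t, y) * cauchy_kernel c r x t)) (at y)"
proof -
  note cont = holomorphic2_on_imp_continuous_on[OF f]
  have diff1: "(\<lambda>t. f (t, snd p)) field_differentiable at (fst p)" if "p \<in> D" for p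
    using has_pd1[OF f D that] by (auto simp: field_differentiable_def)
  have diff2: "(\<lambda>t. f (fst p, t)) field_differentiable at (snd p)" if "p \<in> D" for p
    using has_pd2[OF f D that] by (auto simp: field_differentiable_def)
  have circ: "(circlepath c r t, s) \<in> D" if "s \<in> ball d r" "t \<in> {0..1}" for s t
    using circlepath_in_sphere[of r t c] that r by auto
  have cont_slice: "continuous_on (ball d r \<times> {0..1})
      (\<lambda>(s, t). h (circlepath c r t, s) * cauchy_kernel c r x t)"
    if "continuous_on D h" for h
  proof -
    have "continuous_on (ball d r \<times> {0..1})
        ((\<lambda>(p, t). h (circlepath c r t, snd p) * cauchy_kernel c r (fst p) t)
          \<circ> (\<lambda>q. ((x, fst q), snd q)))"
      using r(3) by (intro continuous_on_compose continuous_intros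
          continuous_on_subset[OF continuous_on_cauchy_integrand[OF that r(1,2)]]) auto
    then show ?thesis by (simp add: case_prod_beta comp_def)
  qed
  have A: "((\<lambda>s. f (circlepath c r t, s) * cauchy_kernel c r x t) has_field_derivative
      pd2 f (circlepath c r t, s) * cauchy_kernel c r x t) (at s within ball d r)"
    if "s \<in> ball d r" "t \<in> cbox 0 1" for s t
  proof -
    have "((\<lambda>s. f (circlepath c r t, s)) has_field_derivative pd2 f (circlepath c r t, s))
        (at s within ball d r)"
      using has_pd2[OF f D circ[OF that[unfolded box_real]]]
      by (simp add: has_field_derivative_at_within)
    then show ?thesis by (rule DERIV_cmult_right)
  qed
  have B: "(\<lambda>t. f (circlepath c r t, s) * cauchy_kernel c r x t) integrable_on cbox 0 1"
    if "s \<in> ball d r" for s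
  proof -
    have "continuous_on (cbox 0 1)
        ((\<lambda>(s, t). f (circlepath c r t, s) * cauchy_kernel c r x t) \<circ> Pair s)"
      using that by (intro continuous_on_compose continuous_intros
          continuous_on_subset[OF cont_slice[OF cont]]) auto
    then show ?thesis by (intro integrable_continuous) (simp add: comp_def)
  qed
  have C: "continuous_on (ball d r \<times> cbox 0 1)
      (\<lambda>(s, t). pd2 f (circlepath c r t, s) * cauchy_kernel c r x t)"
    unfolding box_real by (rule cont_slice[OF continuous_on_pd2[OF D cont diff2]])
  have "((\<lambda>s. integral (cbox 0 1) (\<lambda>t. f (circlepath c r t, s) * cauchy_kernel c r x t))
      has_field_derivative
        integral (cbox 0 1) (\<lambda>t. pd2 f (circlepath c r t, y) * cauchy_kernel c r x t))
      (at y within ball d r)"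
    by (rule leibniz_rule_field_derivative[where f = "\<lambda>s t. f (circlepath c r t, s) * cauchy_kernel c r x t"
          and fx = "\<lambda>s t. pd2 f (circlepath c r t, s) * cauchy_kernel c r x t", OF A B C r(4) convex_ball])
  then have *: "((\<lambda>s. integral {0..1} (\<lambda>t. f (circlepath c r t, s) * cauchy_kernel c r x t))
      has_field_derivative
        integral {0..1} (\<lambda>t. pd2 f (circlepath c r t, y) * cauchy_kernel c r x t)) (at y)"
    unfolding at_within_open[OF r(4) open_ball] box_real .
  show ?thesis
  proof (rule has_field_derivative_transform_within_open[OF *])
    fix s assume "s \<in> ball d r"
    then show "integral {0..1} (\<lambda>t. f (circlepath c r t, s) * cauchy_kernel c r x t) = pd1 f (x, s)"
      unfolding pd1_def fst_conv snd_conv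
      by (intro DERIV_imp_deriv[symmetric] has_pd1_cauchy[OF cont diff1]) (use r in auto)
  qed (use r in auto)
qed

text \<open>The first claim is one-variable theory: on the slice of \<open>D\<close> through
  \<open>p\<close>, the derivative of a holomorphic function is holomorphic. The second comes from
  differentiating Cauchy's integral with respect to its parameter.\<close>

lemma has_pd_pd1:
  assumes D: "open D" and f: "f holomorphic2_on D" and p: "p \<in> D"
  shows "(\<lambda>t. pd1 f (t, snd p)) field_differentiable at (fst p)"
    and "((\<lambda>t. pd1 f (fst p, t)) has_field_derivative pd2 (pd1 f) p) (at (snd p))"
proof -
  define S where "S = (\<lambda>t. (t, snd p)) -` D"
  have "open S" unfolding S_def by (intro open_vimage D continuous_intros)
  have "(\<lambda>t. f (t, snd p)) holomorphic_on S"
    using has_pd1[OF f D, of "(_, snd p)"] \<open>open S\<close>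
    by (auto simp: S_def holomorphic_on_open)
  then have "deriv (\<lambda>t. f (t, snd p)) holomorphic_on S"
    using \<open>open S\<close> by (rule holomorphic_deriv)
  then show "(\<lambda>t. pd1 f (t, snd p)) field_differentiable at (fst p)"
    using \<open>open S\<close> p by (auto simp: pd1_def S_def holomorphic_on_open field_differentiable_def)
  obtain r where r: "0 < r" "cball (fst p) r \<times> cball (snd p) r \<subseteq> D"
    using polydisc_in_open D p by (metis prod.collapse)
  then have "cball (fst p) r \<times> ball (snd p) r \<subseteq> D" by auto
  then have *: "((\<lambda>t. pd1 f (fst p, t)) has_field_derivative
      integral {0..1} (\<lambda>t. pd2 f (circlepath (fst p) r t, snd p) * cauchy_kernel (fst p) r (fst p) t))
      (at (snd p))"
    using has_pd2_pd1_cauchy[OF D f r(1), of "fst p" "snd p"] r(1) by simp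
  then show "((\<lambda>t. pd1 f (fst p, t)) has_field_derivative pd2 (pd1 f) p) (at (snd p))"
    unfolding pd2_def[of "pd1 f"] DERIV_imp_deriv[OF *] .
qed

lemma holomorphic2_on_pd1:
  assumes D: "open D" and f: "f holomorphic2_on D"
  shows "pd1 f holomorphic2_on D"
proof (rule osgood[OF D])
  show "continuous_on D (pd1 f)"
    using has_pd1[OF f D]
    by (intro continuous_on_pd1 D holomorphic2_on_imp_continuous_on[OF f])
      (auto simp: field_differentiable_def)
  show "(\<lambda>t. pd1 f (t, snd p)) field_differentiable at (fst p)"
    "(\<lambda>t. pd1 f (fst p, t)) field_differentiable at (snd p)" if "p \<in> D" for p
    using has_pd_pd1[OF D f that] unfolding field_differentiable_def by blast+
qed

lemma holomorphic2_on_pd2: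
  assumes D: "open D" and f: "f holomorphic2_on D"
  shows "pd2 f holomorphic2_on D"
proof -
  have "(pd1 (f \<circ> prod.swap) \<circ> prod.swap) holomorphic2_on (prod.swap -` (prod.swap -` D))"
    by (rule holomorphic2_on_swap[OF open_swap[OF D]
          holomorphic2_on_pd1[OF open_swap[OF D] holomorphic2_on_swap[OF D f]]])
  moreover have "pd1 (f \<circ> prod.swap) \<circ> prod.swap = pd2 f" by (simp add: fun_eq_iff pd1_swap)
  moreover have "prod.swap -` (prod.swap -` D) = D" by auto
  ultimately show ?thesis by simp
qed

text \<open>Both sides equal the same integral \<open>?I\<close>: the left one by differentiation
  under the integral sign, the right one by Cauchy's formula for the holomorphic function
  \<open>pd2 f\<close>.\<close>

lemma pd2_pd1_commute:
  assumes D: "open D" and f: "f holomorphic2_on D" and p: "p \<in> D"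
  shows "pd2 (pd1 f) p = pd1 (pd2 f) p"
proof -
  obtain r where r: "0 < r" "cball (fst p) r \<times> cball (snd p) r \<subseteq> D"
    using polydisc_in_open D p by (metis prod.collapse)
  have sub: "cball (fst p) r \<times> ball (snd p) r \<subseteq> D" "cball (fst p) r \<times> {snd p} \<subseteq> D"
    using r by auto
  note pd2 = holomorphic2_on_pd2[OF D f]
  let ?I = "integral {0..1} (\<lambda>t. pd2 f (circlepath (fst p) r t, snd p) * cauchy_kernel (fst p) r (fst p) t)"
  have "pd2 (pd1 f) p = ?I"
    unfolding pd2_def[of "pd1 f"]
    using has_pd2_pd1_cauchy[OF D f r(1) sub(1), of "fst p" "snd p"] r(1)
    by (intro DERIV_imp_deriv) simp
  also have "?I = pd1 (pd2 f) p"
    unfolding pd1_def[of "pd2 f"]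
    using has_pd1[OF pd2 D] r(1)
    by (intro DERIV_imp_deriv[symmetric] has_pd1_cauchy[OF holomorphic2_on_imp_continuous_on[OF pd2] _ sub(2)])
      (auto simp: field_differentiable_def)
  finally show ?thesis .
qed

section \<open>Calculus rules for functions of two variables\<close>

lemma pd_cong:
  assumes "open D" "p \<in> D" "\<And>q. q \<in> D \<Longrightarrow> f q = g q"
  shows "pd1 f p = pd1 g p" "pd2 f p = pd2 g p"
proof -
  have "\<forall>\<^sub>F t in nhds (fst p). (t, snd p) \<in> D" "\<forall>\<^sub>F t in nhds (snd p). (fst p, t) \<in> D"
    using assms(1,2)
    by (auto intro!: eventually_nhds_in_open[of "(\<lambda>t. (t, snd p)) -` D", simplified]
          eventually_nhds_in_open[of "(\<lambda>t. (fst p, t)) -` D", simplified]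
          open_vimage continuous_intros)
  then show "pd1 f p = pd1 g p" "pd2 f p = pd2 g p"
    unfolding pd1_def pd2_def using assms(3)
    by (auto intro!: deriv_cong_ev elim!: eventually_mono)
qed

lemma holomorphic2_on_partials:
  assumes "f holomorphic2_on D" "open D" "p \<in> D"
  shows "(\<lambda>t. f (t, snd p)) field_differentiable at (fst p)"
    and "(\<lambda>t. f (fst p, t)) field_differentiable at (snd p)"
  unfolding field_differentiable_def
  by (rule exI, rule has_pd1[OF assms], rule exI, rule has_pd2[OF assms])

lemma holomorphic2_on_const: "(\<lambda>p. c) holomorphic2_on D"
  unfolding holomorphic2_on_def by (rule ballI, rule exI[of _ 0], rule exI[of _ 0]) simp

text \<open>Osgood's lemma reduces each closure rule to continuity and to the one-variable rule
  along the coordinate lines.\<close>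

lemma
  assumes D: "open D" and f: "f holomorphic2_on D" and g: "g holomorphic2_on D"
  shows holomorphic2_on_add: "(\<lambda>p. f p + g p) holomorphic2_on D"
    and holomorphic2_on_diff: "(\<lambda>p. f p - g p) holomorphic2_on D"
    and holomorphic2_on_mult: "(\<lambda>p. f p * g p) holomorphic2_on D"
    and holomorphic2_on_divide: "(\<And>p. p \<in> D \<Longrightarrow> g p \<noteq> 0) \<Longrightarrow> (\<lambda>p. f p / g p) holomorphic2_on D"
proof -
  note c = holomorphic2_on_imp_continuous_on[OF f] holomorphic2_on_imp_continuous_on[OF g]
  note d1 = holomorphic2_on_partials(1)[OF f D] holomorphic2_on_partials(1)[OF g D]
  note d2 = holomorphic2_on_partials(2)[OF f D] holomorphic2_on_partials(2)[OF g D]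
  show "(\<lambda>p. f p + g p) holomorphic2_on D"
    by (rule osgood[OF D continuous_on_add[OF c]]; intro field_differentiable_add d1 d2; assumption)
  show "(\<lambda>p. f p - g p) holomorphic2_on D"
    by (rule osgood[OF D continuous_on_diff[OF c]]; intro field_differentiable_diff d1 d2; assumption)
  show "(\<lambda>p. f p * g p) holomorphic2_on D"
    by (rule osgood[OF D continuous_on_mult[OF c]]; intro field_differentiable_mult d1 d2; assumption)
  show "(\<lambda>p. f p / g p) holomorphic2_on D" if nz: "\<And>p. p \<in> D \<Longrightarrow> g p \<noteq> 0"
  proof (rule osgood[OF D])
    show "continuous_on D (\<lambda>p. f p / g p)"
      using nz by (intro continuous_on_divide c) blast
    fix p assume p: "p \<in> D"
    show "(\<lambda>t. f (t, snd p) / g (t, snd p)) field_differentiable at (fst p)"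
      "(\<lambda>t. f (fst p, t) / g (fst p, t)) field_differentiable at (snd p)"
      using nz[OF p] by (auto intro!: field_differentiable_divide d1 d2 p)
  qed
qed

text \<open>This is the shape of the right-hand sides of the second-order system; the expressions
  for \<open>P1\<close>, \<open>P2\<close> and the first derivatives of \<open>z\<close> are brought
  into the same shape in order to use it.\<close>

lemma pd_linear_combination:
  assumes D: "open D" and h: "a holomorphic2_on D" "f holomorphic2_on D" "b holomorphic2_on D"
    "g holomorphic2_on D" and p: "p \<in> D"
  shows "pd1 (\<lambda>q. a q * f q + b q * g q) p =
           pd1 a p * f p + a p * pd1 f p + (pd1 b p * g p + b p * pd1 g p)"
    and "pd2 (\<lambda>q. a q * f q + b q * g q) p =
           pd2 a p * f p + a p * pd2 f p + (pd2 b p * g p + b p * pd2 g p)"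
proof -
  note d1 = h[THEN has_pd1, OF D p]
  show "pd1 (\<lambda>q. a q * f q + b q * g q) p =
           pd1 a p * f p + a p * pd1 f p + (pd1 b p * g p + b p * pd1 g p)"
    unfolding pd1_def[of "\<lambda>q. a q * f q + b q * g q"]
    using DERIV_imp_deriv[OF DERIV_add[OF DERIV_mult[OF d1(1,2)] DERIV_mult[OF d1(3,4)]]]
    by (simp add: algebra_simps)
  note d2 = h[THEN has_pd2, OF D p]
  show "pd2 (\<lambda>q. a q * f q + b q * g q) p =
           pd2 a p * f p + a p * pd2 f p + (pd2 b p * g p + b p * pd2 g p)"
    unfolding pd2_def[of "\<lambda>q. a q * f q + b q * g q"]
    using DERIV_imp_deriv[OF DERIV_add[OF DERIV_mult[OF d2(1,2)] DERIV_mult[OF d2(3,4)]]]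
    by (simp add: algebra_simps)
qed

text \<open>No branch of the cube root is chosen; continuity of \<open>g\<close> is enough. Dividing
  the difference quotient of \<open>g ^ 3\<close> by the cofactor \<open>k\<close> of
  \<open>g y - g x\<close> leaves that of \<open>g\<close>, and \<open>k\<close> tends to
  \<open>3 * (g x)\<^sup>2\<close>, which is not zero.\<close>

lemma cube_root_has_field_derivative:
  fixes g :: "complex \<Rightarrow> complex"
  assumes "isCont g x" "g x \<noteq> 0" "((\<lambda>t. g t ^ 3) has_field_derivative d) (at x)"
  shows "(g has_field_derivative d / (3 * (g x)\<^sup>2)) (at x)"
proof -
  define k where "k y = (g y)\<^sup>2 + g y * g x + (g x)\<^sup>2" for y
  have g: "(g \<longlongrightarrow> g x) (at x)" using assms(1) by (simp add: isCont_def)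
  have k: "(k \<longlongrightarrow> 3 * (g x)\<^sup>2) (at x)"
    unfolding k_def by (rule tendsto_eq_intros g | simp add: power2_eq_square)+
  have nz: "\<forall>\<^sub>F y in at x. k y \<noteq> 0"
    using tendsto_imp_eventually_ne[OF k] assms(2) by simp
  have "((\<lambda>y. (g y ^ 3 - g x ^ 3) / (y - x) / k y) \<longlongrightarrow> d / (3 * (g x)\<^sup>2)) (at x)"
    using assms(2,3) by (intro tendsto_divide k) (simp_all add: has_field_derivative_iff)
  moreover have "\<forall>\<^sub>F y in at x. (g y ^ 3 - g x ^ 3) / (y - x) / k y = (g y - g x) / (y - x)"
    using nz
  proof eventually_elim
    case (elim y)
    have "g y ^ 3 - g x ^ 3 = (g y - g x) * k y"
      by (simp add: k_def algebra_simps power2_eq_square power3_eq_cube)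
    with elim show ?case by simp
  qed
  ultimately show ?thesis
    unfolding has_field_derivative_iff by (rule Lim_transform_eventually)
qed

subsection \<open>The Jacobian of the local inverse\<close>

text \<open>By the chain rule the product of the two Jacobian matrices is the identity matrix, and
  determinants are multiplicative.\<close>

lemma jacobian_det_inverse:
  assumes inv: "holomorphic_inverse_on U w1 w2 v1 v2" and p: "p \<in> U"
  shows "jacobian_det v1 v2 (w1 p, w2 p) * jacobian_det w1 w2 p = 1"
proof -
  define W where "W = (\<lambda>q. (w1 q, w2 q))"
  have U: "open U" and w: "w1 holomorphic2_on U" "w2 holomorphic2_on U" and V: "open (W ` U)"
    and v: "v1 holomorphic2_on (W ` U)" "v2 holomorphic2_on (W ` U)"
    and id: "\<And>q. q \<in> U \<Longrightarrow> v1 (W q) = fst q" "\<And>q. q \<in> U \<Longrightarrow> v2 (W q) = snd q"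
    using inv by (auto simp: holomorphic_inverse_on_def W_def prod_eq_iff)
  note dw = has_derivative_holomorphic2[OF w(1) U p] has_derivative_holomorphic2[OF w(2) U p]
  have dW: "(W has_derivative (\<lambda>h. (pd1 w1 p * fst h + pd2 w1 p * snd h,
      pd1 w2 p * fst h + pd2 w2 p * snd h))) (at p)"
    unfolding W_def by (rule has_derivative_Pair[OF dw])
  \<comment> \<open>Here \<open>l\<close> stands for either coordinate projection. It is its own
    derivative, and evaluation at the two unit vectors gives one row of the matrix product.\<close>
  have entries: "pd1 v (W p) * pd1 w1 p + pd2 v (W p) * pd1 w2 p = l (1, 0)"
      "pd1 v (W p) * pd2 w1 p + pd2 v (W p) * pd2 w2 p = l (0, 1)"
    if v: "v holomorphic2_on (W ` U)" and id: "\<And>q. q \<in> U \<Longrightarrow> v (W q) = l q"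
      and l: "bounded_linear l" for v l
  proof -
    have "(v has_derivative (\<lambda>h. pd1 v (W p) * fst h + pd2 v (W p) * snd h)) (at (W p))"
      using has_derivative_holomorphic2[OF v V] p by blast
    from has_derivative_compose[OF dW this]
    have "(l has_derivative (\<lambda>h. pd1 v (W p) * (pd1 w1 p * fst h + pd2 w1 p * snd h)
          + pd2 v (W p) * (pd1 w2 p * fst h + pd2 w2 p * snd h))) (at p)"
      by (auto intro: has_derivative_transform_within_open[OF _ U p] simp: id)
    then have "(\<lambda>h. pd1 v (W p) * (pd1 w1 p * fst h + pd2 w1 p * snd h)
          + pd2 v (W p) * (pd1 w2 p * fst h + pd2 w2 p * snd h)) = l"
      by (rule has_derivative_unique) (rule bounded_linear_imp_has_derivative[OF l])
    from fun_cong[OF this, of "(1, 0)"] fun_cong[OF this, of "(0, 1)"]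
    show "pd1 v (W p) * pd1 w1 p + pd2 v (W p) * pd1 w2 p = l (1, 0)"
      "pd1 v (W p) * pd2 w1 p + pd2 v (W p) * pd2 w2 p = l (0, 1)" by simp_all
  qed
  have *: "a * e + b * g = 1 \<Longrightarrow> a * f + b * h = 0 \<Longrightarrow> c * e + d * g = 0 \<Longrightarrow> c * f + d * h = 1
      \<Longrightarrow> (a * d - b * c) * (e * h - f * g) = 1" for a b c d e f g h :: complex
    by algebra
  show ?thesis
    unfolding jacobian_det_def
    using entries[OF v(1) id(1) bounded_linear_fst] entries[OF v(2) id(2) bounded_linear_snd]
    by (intro *) (simp_all add: W_def)
qed

text \<open>The inverse function theorem yields a real differentiable inverse. Its derivative is the
  inverse of a complex matrix, hence complex linear, and so the inverse is holomorphic.\<close>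

lemma holomorphic_inverse_exists:
  assumes D: "open D" and w: "w1 holomorphic2_on D" "w2 holomorphic2_on D" and p: "p \<in> D"
    and J: "\<And>q. q \<in> D \<Longrightarrow> jacobian_det w1 w2 q \<noteq> 0"
  obtains U v1 v2 where "p \<in> U" "holomorphic_inverse_on U w1 w2 v1 v2"
proof -
  define f where "f q = (w1 q, w2 q)" for q
  define f' where "f' q h = (pd1 w1 q * fst h + pd2 w1 q * snd h,
      pd1 w2 q * fst h + pd2 w2 q * snd h)" for q h
  \<comment> \<open>The inverse matrix, as the adjugate divided by the determinant.\<close>
  define j' where "j' q k = ((pd2 w2 q * fst k - pd2 w1 q * snd k) / jacobian_det w1 w2 q,
      (pd1 w1 q * snd k - pd1 w2 q * fst k) / jacobian_det w1 w2 q)" for q k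
  have bl: "bounded_linear (f' q)" "bounded_linear (j' q)" for q
    unfolding f'_def j'_def
    by (intro bounded_linear_Pair bounded_linear_add bounded_linear_sub bounded_linear_divide
        bounded_linear_compose[OF bounded_linear_divide]
        bounded_linear_const_mult bounded_linear_fst bounded_linear_snd)+
  have j'f': "j' q (f' q h) = h" and f'j': "f' q (j' q h) = h" if "q \<in> D" for q h
  proof -
    have "pd1 w1 q * pd2 w2 q - pd2 w1 q * pd1 w2 q \<noteq> 0"
      using J[OF that] by (simp add: jacobian_det_def)
    then show "j' q (f' q h) = h" "f' q (j' q h) = h"
      by (simp_all add: f'_def j'_def jacobian_det_def prod_eq_iff divide_simps)
        (simp_all add: algebra_simps)
  qed
  have Bf: "blinfun_apply (Blinfun (f' q)) = f' q" "blinfun_apply (Blinfun (j' q)) = j' q" for q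
    using bl by (simp_all add: bounded_linear_Blinfun_apply)
  have der: "(f has_derivative blinfun_apply (Blinfun (f' q))) (at q)" if "q \<in> D" for q
    unfolding Bf unfolding f_def f'_def
    by (intro has_derivative_Pair has_derivative_holomorphic2[OF _ D that] w)
  have "continuous_on D (\<lambda>q. f' q h)" for h
    unfolding f'_def
    by (intro continuous_intros holomorphic2_on_imp_continuous_on
        holomorphic2_on_pd1 holomorphic2_on_pd2 D w)
  then have cont: "continuous_on D (\<lambda>q. Blinfun (f' q))"
    by (intro continuous_on_blinfun_componentwise) (simp add: Bf)
  have "Blinfun (j' p) o\<^sub>L Blinfun (f' p) = id_blinfun"
    by (rule blinfun_eqI) (simp add: Bf j'f'[OF p])
  from inverse_function_theorem[OF D der cont p this]
  obtain U V g g' where U: "open U" "U \<subseteq> D" "p \<in> U" and V: "open V" "homeomorphism U V f g"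
    and g: "\<And>y. y \<in> V \<Longrightarrow> (g has_derivative g' y) (at y)"
    and g': "\<And>y. y \<in> V \<Longrightarrow> g' y = inv (blinfun_apply (Blinfun (f' (g y))))"
    by metis
  have fU: "f ` U = V" and gf: "\<And>q. q \<in> U \<Longrightarrow> g (f q) = q" and gV: "g ` V = U"
    using V(2) by (auto simp: homeomorphism_def)
  have dg: "(g has_derivative j' (g y)) (at y)" if "y \<in> V" for y
  proof -
    have "g y \<in> D" using that gV U by auto
    then have "inv (f' (g y)) = j' (g y)"
      by (intro inv_equality) (simp_all add: j'f' f'j')
    then show ?thesis using g[OF that] g'[OF that] by (simp add: Bf)
  qed
  have "(\<lambda>y. fst (g y)) holomorphic2_on V" "(\<lambda>y. snd (g y)) holomorphic2_on V"
    unfolding holomorphic2_on_def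
  proof safe
    fix a b assume y: "(a, b) \<in> V"
    let ?q = "g (a, b)" let ?J = "jacobian_det w1 w2 ?q"
    \<comment> \<open>The explicit coefficients exhibit both components as complex linear forms,
      which is what \<open>holomorphic2_on\<close> demands.\<close>
    have eq: "(\<lambda>h. fst (j' ?q h)) = (\<lambda>h. (pd2 w2 ?q / ?J) * fst h + (- pd2 w1 ?q / ?J) * snd h)"
      "(\<lambda>h. snd (j' ?q h)) = (\<lambda>h. (- pd1 w2 ?q / ?J) * fst h + (pd1 w1 ?q / ?J) * snd h)"
      by (auto simp: j'_def fun_eq_iff diff_divide_distrib)
    have "((\<lambda>y. fst (g y)) has_derivative (\<lambda>h. fst (j' ?q h))) (at (a, b) within V)"
      "((\<lambda>y. snd (g y)) has_derivative (\<lambda>h. snd (j' ?q h))) (at (a, b) within V)"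
      by (intro has_derivative_fst has_derivative_snd has_derivative_at_withinI[OF dg[OF y]])+
    then show "\<exists>c d. ((\<lambda>y. fst (g y)) has_derivative (\<lambda>h. c * fst h + d * snd h)) (at (a, b) within V)"
      "\<exists>c d. ((\<lambda>y. snd (g y)) has_derivative (\<lambda>h. c * fst h + d * snd h)) (at (a, b) within V)"
      unfolding eq by blast+
  qed
  moreover have "w1 holomorphic2_on U" "w2 holomorphic2_on U"
    using w U D unfolding holomorphic2_on_def by (meson has_derivative_subset subsetD)+
  ultimately have "holomorphic_inverse_on U w1 w2 (\<lambda>y. fst (g y)) (\<lambda>y. snd (g y))"
    using U V fU gf by (simp add: holomorphic_inverse_on_def f_def[abs_def])
  with U show ?thesis using that by blast
qed

text \<open>The definite description is meaningful: a local inverse exists, and each one has the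
  reciprocal of the Jacobian of \<open>(w1, w2)\<close> as its own Jacobian at the image
  point.\<close>

lemma inverse_jacobian_eq:
  assumes "open D" "w1 holomorphic2_on D" "w2 holomorphic2_on D" "p \<in> D"
    and "\<And>q. q \<in> D \<Longrightarrow> jacobian_det w1 w2 q \<noteq> 0"
  shows "inverse_jacobian w1 w2 p = 1 / jacobian_det w1 w2 p"
proof -
  obtain U v1 v2 where "p \<in> U" "holomorphic_inverse_on U w1 w2 v1 v2"
    using holomorphic_inverse_exists[OF assms] by metis
  moreover have "jacobian_det a b (w1 p, w2 p) = 1 / jacobian_det w1 w2 p"
    if "p \<in> S" "holomorphic_inverse_on S w1 w2 a b" for S a b
    using jacobian_det_inverse[OF that(2,1)] assms(5)[OF assms(4)] by (simp add: field_simps)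
  ultimately show ?thesis
    unfolding inverse_jacobian_def by (intro the_equality) metis+
qed

subsection \<open>Second-order linear systems with two independent solutions\<close>

text \<open>In the application \<open>(a, b)\<close> and \<open>(c, d)\<close> are the gradients of
  \<open>w1\<close> and \<open>w2\<close>, while \<open>f\<close> and \<open>g\<close> are the same
  second derivative of these two functions.\<close>

lemma cramer:
  fixes a b c d f g :: complex
  assumes "a * d - b * c \<noteq> 0"
  shows "f = (d * f - b * g) / (a * d - b * c) * a + (a * g - c * f) / (a * d - b * c) * b"
    and "g = (d * f - b * g) / (a * d - b * c) * c + (a * g - c * f) / (a * d - b * c) * d"
  unfolding times_divide_eq_left add_divide_distrib[symmetric] nonzero_eq_divide_eq[OF assms]
  by (simp_all add: algebra_simps)

lemma cramer_unique:
  fixes a b c d s t s' t' :: complex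
  assumes "a * d - b * c \<noteq> 0" "s * a + t * b = s' * a + t' * b" "s * c + t * d = s' * c + t' * d"
  shows "s = s'" "t = t'"
proof -
  have "(a * d - b * c) * (s - s') = 0" "(a * d - b * c) * (t - t') = 0"
    using assms(2,3) by algebra+
  then show "s = s'" "t = t'" using assms(1) by auto
qed

locale second_order_system =
  fixes D :: "(complex \<times> complex) set" and A B C E G H :: "complex \<times> complex \<Rightarrow> complex"
  assumes D: "open D"
    and coeffs: "A holomorphic2_on D" "B holomorphic2_on D" "C holomorphic2_on D"
      "E holomorphic2_on D" "G holomorphic2_on D" "H holomorphic2_on D"
begin

definition is_solution :: "(complex \<times> complex \<Rightarrow> complex) \<Rightarrow> bool"
  where "is_solution u \<longleftrightarrow> u holomorphic2_on D \<and> (\<forall>p\<in>D.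
    pd1 (pd1 u) p = A p * pd1 u p + B p * pd2 u p \<and>
    pd1 (pd2 u) p = C p * pd1 u p + E p * pd2 u p \<and>
    pd2 (pd2 u) p = G p * pd1 u p + H p * pd2 u p)"

text \<open>The two claims compare two computations of the mixed third derivatives xxy and xyy
  respectively, with all second derivatives eliminated by the system.\<close>

lemma solution_third_derivatives:
  assumes u: "is_solution u" and p: "p \<in> D"
  shows "(pd2 A p + A p * C p + B p * G p) * pd1 u p + (pd2 B p + A p * E p + B p * H p) * pd2 u p =
      (pd1 C p + C p * A p + E p * C p) * pd1 u p + (pd1 E p + C p * B p + E p * E p) * pd2 u p"
    and "(pd2 C p + C p * C p + E p * G p) * pd1 u p + (pd2 E p + C p * E p + E p * H p) * pd2 u p =
      (pd1 G p + G p * A p + H p * C p) * pd1 u p + (pd1 H p + G p * B p + H p * E p) * pd2 u p"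
proof -
  have hol: "u holomorphic2_on D" using u by (simp add: is_solution_def)
  note hol1 = holomorphic2_on_pd1[OF D hol] and hol2 = holomorphic2_on_pd2[OF D hol]
  have xx: "pd1 (pd1 u) q = A q * pd1 u q + B q * pd2 u q"
    and xy: "pd1 (pd2 u) q = C q * pd1 u q + E q * pd2 u q"
    and yx: "pd2 (pd1 u) q = C q * pd1 u q + E q * pd2 u q"
    and yy: "pd2 (pd2 u) q = G q * pd1 u q + H q * pd2 u q" if "q \<in> D" for q
    using u that pd2_pd1_commute[OF D hol that] by (auto simp: is_solution_def)
  note lin = pd_linear_combination[OF D _ hol1 _ hol2 p]
  have "pd2 (\<lambda>q. A q * pd1 u q + B q * pd2 u q) p = pd2 (pd1 (pd1 u)) p"
    by (rule pd_cong[OF D p]) (simp add: xx)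
  also have "\<dots> = pd1 (pd2 (pd1 u)) p" by (rule pd2_pd1_commute[OF D hol1 p])
  also have "\<dots> = pd1 (\<lambda>q. C q * pd1 u q + E q * pd2 u q) p"
    by (rule pd_cong[OF D p]) (simp add: yx)
  finally show "(pd2 A p + A p * C p + B p * G p) * pd1 u p + (pd2 B p + A p * E p + B p * H p) * pd2 u p =
      (pd1 C p + C p * A p + E p * C p) * pd1 u p + (pd1 E p + C p * B p + E p * E p) * pd2 u p"
    by (simp add: lin coeffs xx[OF p] xy[OF p] yx[OF p] yy[OF p] algebra_simps)
  have "pd2 (\<lambda>q. C q * pd1 u q + E q * pd2 u q) p = pd2 (pd1 (pd2 u)) p"
    by (rule pd_cong[OF D p]) (simp add: xy)
  also have "\<dots> = pd1 (pd2 (pd2 u)) p" by (rule pd2_pd1_commute[OF D hol2 p])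
  also have "\<dots> = pd1 (\<lambda>q. G q * pd1 u q + H q * pd2 u q) p"
    by (rule pd_cong[OF D p]) (simp add: yy)
  finally show "(pd2 C p + C p * C p + E p * G p) * pd1 u p + (pd2 E p + C p * E p + E p * H p) * pd2 u p =
      (pd1 G p + G p * A p + H p * C p) * pd1 u p + (pd1 H p + G p * B p + H p * E p) * pd2 u p"
    by (simp add: lin coeffs xx[OF p] xy[OF p] yx[OF p] yy[OF p] algebra_simps)
qed

text \<open>Each relation between third derivatives, taken for \<open>u1\<close> and
  \<open>u2\<close>, is a pair of linear equations with the nonzero determinant
  \<open>jacobian_det u1 u2 p\<close>. So the coefficients of the first derivatives agree;
  \<open>A p * C p\<close> cancels in the first identity and \<open>E p * H p\<close> in the
  last.\<close>

lemma integrability: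
  assumes u: "is_solution u1" "is_solution u2" and p: "p \<in> D" and J: "jacobian_det u1 u2 p \<noteq> 0"
  shows "pd2 A p + B p * G p = pd1 C p + E p * C p"
    and "pd2 B p + A p * E p + B p * H p = pd1 E p + C p * B p + E p * E p"
    and "pd2 C p + C p * C p + E p * G p = pd1 G p + G p * A p + H p * C p"
    and "pd2 E p + C p * E p = pd1 H p + G p * B p"
proof -
  note J = J[unfolded jacobian_det_def]
  note T1 = solution_third_derivatives[OF u(1) p] and T2 = solution_third_derivatives[OF u(2) p]
  note R1 = cramer_unique[OF J T1(1) T2(1)] and R2 = cramer_unique[OF J T1(2) T2(2)]
  show "pd2 A p + B p * G p = pd1 C p + E p * C p" using R1(1) by (simp add: algebra_simps)
  show "pd2 B p + A p * E p + B p * H p = pd1 E p + C p * B p + E p * E p" by (rule R1(2))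
  show "pd2 C p + C p * C p + E p * G p = pd1 G p + G p * A p + H p * C p" by (rule R2(1))
  show "pd2 E p + C p * E p = pd1 H p + G p * B p" using R2(2) by (simp add: algebra_simps)
qed

text \<open>This is Liouville's formula for a Wronskian: the factors are the traces of the matrices
  with rows \<open>(A, B)\<close>, \<open>(C, E)\<close> and \<open>(C, E)\<close>,
  \<open>(G, H)\<close> by which the system differentiates the gradient of a solution.\<close>

lemma has_pd_jacobian:
  assumes u: "is_solution u1" "is_solution u2" and p: "p \<in> D"
  shows "((\<lambda>t. jacobian_det u1 u2 (t, snd p)) has_field_derivative
           (A p + E p) * jacobian_det u1 u2 p) (at (fst p))"
    and "((\<lambda>t. jacobian_det u1 u2 (fst p, t)) has_field_derivative
           (C p + H p) * jacobian_det u1 u2 p) (at (snd p))"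
proof -
  have hol: "u1 holomorphic2_on D" "u2 holomorphic2_on D"
    using u by (simp_all add: is_solution_def)
  have eqs: "pd1 (pd1 w) p = A p * pd1 w p + B p * pd2 w p"
    "pd1 (pd2 w) p = C p * pd1 w p + E p * pd2 w p"
    "pd2 (pd1 w) p = C p * pd1 w p + E p * pd2 w p"
    "pd2 (pd2 w) p = G p * pd1 w p + H p * pd2 w p" if "is_solution w" for w
    using that p pd2_pd1_commute[OF D _ p] by (auto simp: is_solution_def)
  note X = hol[THEN holomorphic2_on_pd1[OF D]] and Y = hol[THEN holomorphic2_on_pd2[OF D]]
  note X1 = X[THEN has_pd1, OF D p] and X2 = X[THEN has_pd2, OF D p]
    and Y1 = Y[THEN has_pd1, OF D p] and Y2 = Y[THEN has_pd2, OF D p]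
  show "((\<lambda>t. jacobian_det u1 u2 (t, snd p)) has_field_derivative
           (A p + E p) * jacobian_det u1 u2 p) (at (fst p))"
    unfolding jacobian_det_def
    by (rule DERIV_cong[OF DERIV_diff[OF DERIV_mult[OF X1(1) Y1(2)] DERIV_mult[OF Y1(1) X1(2)]]])
      (simp add: eqs[OF u(1)] eqs[OF u(2)] algebra_simps)
  show "((\<lambda>t. jacobian_det u1 u2 (fst p, t)) has_field_derivative
           (C p + H p) * jacobian_det u1 u2 p) (at (snd p))"
    unfolding jacobian_det_def
    by (rule DERIV_cong[OF DERIV_diff[OF DERIV_mult[OF X2(1) Y2(2)] DERIV_mult[OF Y2(1) X2(2)]]])
      (simp add: eqs[OF u(1)] eqs[OF u(2)] algebra_simps)
qed

lemma has_pd_cube_root: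
  assumes u: "is_solution u1" "is_solution u2" and J: "\<And>p. p \<in> D \<Longrightarrow> jacobian_det u1 u2 p \<noteq> 0"
    and U: "open U" "U \<subseteq> D" and z: "continuous_on U z"
    and z3: "\<And>p. p \<in> U \<Longrightarrow> z p ^ 3 = 1 / jacobian_det u1 u2 p" and p: "p \<in> U"
  shows "((\<lambda>t. z (t, snd p)) has_field_derivative - (A p + E p) / 3 * z p) (at (fst p))"
    and "((\<lambda>t. z (fst p, t)) has_field_derivative - (C p + H p) / 3 * z p) (at (snd p))"
proof -
  have "p \<in> D" using p U by blast
  have zJ: "z p ^ 3 * jacobian_det u1 u2 p = 1" using z3[OF p] J[OF \<open>p \<in> D\<close>] by simp
  then have nz: "z p \<noteq> 0" by auto
  have isC: "isCont z p" using z U p by (simp add: continuous_on_eq_continuous_at)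
  \<comment> \<open>The path \<open>h\<close> will be either coordinate line through
    \<open>p\<close>, and \<open>m\<close> the matching logarithmic derivative of the
    Jacobian.\<close>
  have root: "((\<lambda>t. z (h t)) has_field_derivative - m / 3 * z p) (at s)"
    if h: "continuous_on UNIV h" "h s = p"
      and der: "((\<lambda>t. jacobian_det u1 u2 (h t)) has_field_derivative m * jacobian_det u1 u2 p) (at s)"
    for h :: "complex \<Rightarrow> complex \<times> complex" and s m
  proof -
    have nJ: "jacobian_det u1 u2 (h s) \<noteq> 0" using J \<open>p \<in> D\<close> h by simp
    have "((\<lambda>t. 1 / jacobian_det u1 u2 (h t)) has_field_derivative
        - m / jacobian_det u1 u2 p) (at s)"
      using DERIV_divide[OF DERIV_const[of 1] der nJ] h(2) nJ by (simp add: field_simps)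
    moreover have "open (h -` U)" "s \<in> h -` U"
      using h U p by (auto intro!: open_vimage)
    ultimately have "((\<lambda>t. z (h t) ^ 3) has_field_derivative - m / jacobian_det u1 u2 p) (at s)"
      by (rule has_field_derivative_transform_within_open) (simp add: z3)
    moreover have "isCont (\<lambda>t. z (h t)) s"
    proof (rule isCont_o2[where f = h and g = z])
      show "isCont h s" using h(1) by (simp add: continuous_on_eq_continuous_at)
      show "isCont z (h s)" using isC h(2) by simp
    qed
    ultimately have "((\<lambda>t. z (h t)) has_field_derivative
        - m / jacobian_det u1 u2 p / (3 * (z (h s))\<^sup>2)) (at s)"
      using h(2) nz by (intro cube_root_has_field_derivative) simp_all
    moreover have "- m / jacobian_det u1 u2 p / (3 * (z (h s))\<^sup>2) = - m / 3 * z p"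
    proof -
      have "- m / jacobian_det u1 u2 p = - m * z p ^ 3" using z3[OF p] by simp
      then show ?thesis using nz h(2) by (simp add: power2_eq_square power3_eq_cube)
    qed
    ultimately show ?thesis by (rule DERIV_cong)
  qed
  show "((\<lambda>t. z (t, snd p)) has_field_derivative - (A p + E p) / 3 * z p) (at (fst p))"
    by (rule root[OF _ _ has_pd_jacobian(1)[OF u \<open>p \<in> D\<close>]]) (intro continuous_intros, simp)
  show "((\<lambda>t. z (fst p, t)) has_field_derivative - (C p + H p) / 3 * z p) (at (snd p))"
    by (rule root[OF _ _ has_pd_jacobian(2)[OF u \<open>p \<in> D\<close>]]) (intro continuous_intros, simp)
qed

end

section \<open>From the bracket equations to the equations for the cube root\<close>

lemma pd_const: "pd1 (\<lambda>p. c) = (\<lambda>p. 0)" "pd2 (\<lambda>p. c) = (\<lambda>p. 0)"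
  by (simp_all add: pd1_def pd2_def fun_eq_iff)

text \<open>\<open>C\<close> and \<open>E\<close> are the Cramer quotients for the mixed derivative.
  \<open>A\<close> and \<open>H\<close> are defined from \<open>P1\<close> and \<open>P2\<close>, so
  that the last two identities hold as equations of functions, outside \<open>D\<close> too; on
  \<open>D\<close> the brackets show that \<open>A\<close> and \<open>H\<close> are Cramer quotients
  as well.\<close>

lemma solutions_of_brackets:
  fixes w1 w2 :: "complex \<times> complex \<Rightarrow> complex"
  assumes D: "open D" and hol: "w1 holomorphic2_on D" "w2 holomorphic2_on D"
    "F1 holomorphic2_on D" "F2 holomorphic2_on D" "P1 holomorphic2_on D" "P2 holomorphic2_on D"
    and J: "\<And>p. p \<in> D \<Longrightarrow> jacobian_det w1 w2 p \<noteq> 0"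
    and eqs: "\<And>p. p \<in> D \<Longrightarrow> brace_x w1 w2 p = F1 p" "\<And>p. p \<in> D \<Longrightarrow> brace_y w1 w2 p = F2 p"
      "\<And>p. p \<in> D \<Longrightarrow> bracket_x w1 w2 p = P1 p" "\<And>p. p \<in> D \<Longrightarrow> bracket_y w1 w2 p = P2 p"
  obtains A C E H where "second_order_system D A F1 C E F2 H"
    "second_order_system.is_solution D A F1 C E F2 H w1"
    "second_order_system.is_solution D A F1 C E F2 H w2"
    "P1 = (\<lambda>p. 2 * E p + (- 1) * A p)" "P2 = (\<lambda>p. 2 * C p + (- 1) * H p)"
proof -
  define E where "E p = (pd1 w1 p * pd1 (pd2 w2) p - pd1 w2 p * pd1 (pd2 w1) p) / jacobian_det w1 w2 p" for p
  define C where "C p = (pd2 w2 p * pd1 (pd2 w1) p - pd2 w1 p * pd1 (pd2 w2) p) / jacobian_det w1 w2 p" for p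
  define A where "A p = 2 * E p - P1 p" for p
  define H where "H p = 2 * C p - P2 p" for p
  note intros = holomorphic2_on_divide holomorphic2_on_diff holomorphic2_on_mult
    holomorphic2_on_const holomorphic2_on_pd1 holomorphic2_on_pd2
  have hJ: "jacobian_det w1 w2 holomorphic2_on D"
    unfolding jacobian_det_def[abs_def] by (intro intros D hol)
  have hE: "E holomorphic2_on D" and hC: "C holomorphic2_on D"
    unfolding E_def[abs_def] C_def[abs_def] by (intro intros D hol hJ J; assumption)+
  have hA: "A holomorphic2_on D" and hH: "H holomorphic2_on D"
    unfolding A_def[abs_def] H_def[abs_def] by (intro intros D hol hE hC)+
  interpret second_order_system D A F1 C E F2 H
    by (rule second_order_system.intro[OF D hA hol(3) hC hE hol(4) hH])
  have sol: "pd1 (pd1 w1) p = A p * pd1 w1 p + F1 p * pd2 w1 p \<and>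
      pd1 (pd2 w1) p = C p * pd1 w1 p + E p * pd2 w1 p \<and>
      pd2 (pd2 w1) p = F2 p * pd1 w1 p + H p * pd2 w1 p"
    "pd1 (pd1 w2) p = A p * pd1 w2 p + F1 p * pd2 w2 p \<and>
      pd1 (pd2 w2) p = C p * pd1 w2 p + E p * pd2 w2 p \<and>
      pd2 (pd2 w2) p = F2 p * pd1 w2 p + H p * pd2 w2 p" if p: "p \<in> D" for p
  proof -
    let ?J = "pd1 w1 p * pd2 w2 p - pd2 w1 p * pd1 w2 p"
    have J0: "?J \<noteq> 0" using J[OF p] by (simp add: jacobian_det_def)
    have E: "E p = (pd1 w1 p * pd1 (pd2 w2) p - pd1 w2 p * pd1 (pd2 w1) p) / ?J"
      and C: "C p = (pd2 w2 p * pd1 (pd2 w1) p - pd2 w1 p * pd1 (pd2 w2) p) / ?J"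
      by (simp_all add: E_def C_def jacobian_det_def)
    \<comment> \<open>The first summand of \<open>bracket_x\<close> contributes minus the Cramer
      quotient for \<open>A\<close>, the second contributes \<open>2 * E p\<close>; likewise for
      \<open>bracket_y\<close> with \<open>H\<close> and \<open>C\<close>.\<close>
    have A: "A p = (pd2 w2 p * pd1 (pd1 w1) p - pd2 w1 p * pd1 (pd1 w2) p) / ?J"
      and H: "H p = (pd1 w1 p * pd2 (pd2 w2) p - pd1 w2 p * pd2 (pd2 w1) p) / ?J"
      unfolding A_def H_def E C eqs(3)[OF p, symmetric] eqs(4)[OF p, symmetric]
        bracket_x_def bracket_y_def jacobian_det_def
      using J0 by (simp_all add: divide_simps) (simp_all add: algebra_simps)
    have F1: "F1 p = (pd1 w1 p * pd1 (pd1 w2) p - pd1 w2 p * pd1 (pd1 w1) p) / ?J"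
      and F2: "F2 p = (pd2 w2 p * pd2 (pd2 w1) p - pd2 w1 p * pd2 (pd2 w2) p) / ?J"
      unfolding eqs(1)[OF p, symmetric] eqs(2)[OF p, symmetric] brace_x_def brace_y_def jacobian_det_def
      using J0 by (simp_all add: divide_simps) (simp_all add: algebra_simps)
    show "pd1 (pd1 w1) p = A p * pd1 w1 p + F1 p * pd2 w1 p \<and>
      pd1 (pd2 w1) p = C p * pd1 w1 p + E p * pd2 w1 p \<and>
      pd2 (pd2 w1) p = F2 p * pd1 w1 p + H p * pd2 w1 p"
      unfolding A F1 C E F2 H by (intro conjI cramer(1)[OF J0])
    show "pd1 (pd1 w2) p = A p * pd1 w2 p + F1 p * pd2 w2 p \<and>
      pd1 (pd2 w2) p = C p * pd1 w2 p + E p * pd2 w2 p \<and>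
      pd2 (pd2 w2) p = F2 p * pd1 w2 p + H p * pd2 w2 p"
      unfolding A F1 C E F2 H by (intro conjI cramer(2)[OF J0])
  qed
  show ?thesis
  proof (rule that)
    show "second_order_system D A F1 C E F2 H" by (rule second_order_system_axioms)
    show "is_solution w1" "is_solution w2"
      unfolding is_solution_def using hol sol by auto
  qed (simp_all add: A_def H_def fun_eq_iff)
qed

theorem theorem3p2:
  fixes D U :: "(complex \<times> complex) set"
    and F1 F2 P1 P2 w1 w2 z :: "complex \<times> complex \<Rightarrow> complex"
  assumes "open D" and "connected D" and "D \<noteq> {}"
    and "F1 holomorphic2_on D" and "F2 holomorphic2_on D"
    and "P1 holomorphic2_on D" and "P2 holomorphic2_on D"
    and "w1 holomorphic2_on D" and "w2 holomorphic2_on D"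
    and "\<forall>p\<in>D. jacobian_det w1 w2 p \<noteq> 0"
    and "\<forall>p\<in>D. brace_x w1 w2 p = F1 p"
    and "\<forall>p\<in>D. brace_y w1 w2 p = F2 p"
    and "\<forall>p\<in>D. bracket_x w1 w2 p = P1 p"
    and "\<forall>p\<in>D. bracket_y w1 w2 p = P2 p"
    and "open U" and "U \<subseteq> D"
    and "continuous_on U z"
    and "\<forall>p\<in>U. z p ^ 3 = inverse_jacobian w1 w2 p"
  shows "\<forall>p\<in>U.
      pd1 (pd1 z) p + 1/3 * P1 p * pd1 z p - F1 p * pd2 z p
        + (pd2 F1 p - 1/3 * pd1 P1 p - 2/9 * (P1 p)\<^sup>2 - 2/3 * F1 p * P2 p) * z p = 0
    \<and> pd1 (pd2 z) p - 1/3 * P2 p * pd1 z p - 1/3 * P1 p * pd2 z p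
        + (1/3 * pd1 P2 p + 1/3 * pd2 P1 p + 1/9 * P1 p * P2 p - F1 p * F2 p) * z p = 0
    \<and> pd2 (pd2 z) p + 1/3 * P2 p * pd2 z p - F2 p * pd1 z p
        + (pd1 F2 p - 1/3 * pd2 P2 p - 2/9 * (P2 p)\<^sup>2 - 2/3 * F2 p * P1 p) * z p = 0"
proof
  fix p assume pU: "p \<in> U"
  with \<open>U \<subseteq> D\<close> have p: "p \<in> D" by blast
  have J: "jacobian_det w1 w2 q \<noteq> 0" if "q \<in> D" for q using assms(10) that by blast
  obtain A C E H where sys: "second_order_system D A F1 C E F2 H"
    and sol: "second_order_system.is_solution D A F1 C E F2 H w1"
      "second_order_system.is_solution D A F1 C E F2 H w2"
    and P: "P1 = (\<lambda>p. 2 * E p + (- 1) * A p)" "P2 = (\<lambda>p. 2 * C p + (- 1) * H p)"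
    by (rule solutions_of_brackets[OF assms(1,8,9,4-7) J assms(11)[rule_format]
          assms(12)[rule_format] assms(13)[rule_format] assms(14)[rule_format]])
      (assumption | rule that; assumption)+
  interpret second_order_system D A F1 C E F2 H by (rule sys)
  have z3: "z q ^ 3 = 1 / jacobian_det w1 w2 q" if "q \<in> U" for q
    using assms(18) that inverse_jacobian_eq[OF assms(1,8,9) subsetD[OF \<open>U \<subseteq> D\<close> that] J]
    by simp
  have dz: "((\<lambda>t. z (t, snd q)) has_field_derivative - (A q + E q) / 3 * z q) (at (fst q))"
      "((\<lambda>t. z (fst q, t)) has_field_derivative - (C q + H q) / 3 * z q) (at (snd q))"
    if "q \<in> U" for q
    by (rule has_pd_cube_root[OF sol J \<open>open U\<close> \<open>U \<subseteq> D\<close> \<open>continuous_on U z\<close> z3 that]; assumption)+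
  \<comment> \<open>the summand 0 gives \<open>y = - z / 3\<close> the shape required by \<open>pd_linear_combination\<close>\<close>
  define y where "y q = (- 1 / 3) * z q + 0 * z q" for q
  \<comment> \<open>The continuous cube root has both partial derivatives by \<open>dz\<close>, so
    Osgood's lemma makes it holomorphic and it can be differentiated again.\<close>
  have hz: "z holomorphic2_on U"
    by (rule osgood[OF \<open>open U\<close> \<open>continuous_on U z\<close>])
      (unfold field_differentiable_def, (rule exI, erule dz)+)
  have hy: "y holomorphic2_on U"
    unfolding y_def[abs_def]
    by (intro holomorphic2_on_add holomorphic2_on_mult holomorphic2_on_const hz \<open>open U\<close>)
  have z1: "pd1 z q = A q * y q + E q * y q" and z2: "pd2 z q = C q * y q + H q * y q" if "q \<in> U" for q
    unfolding pd1_def[of z] pd2_def[of z] DERIV_imp_deriv[OF dz(1)[OF that]] DERIV_imp_deriv[OF dz(2)[OF that]]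
    by (simp_all add: y_def field_simps)
  have onU: "f holomorphic2_on U" if "f holomorphic2_on D" for f
    using that \<open>U \<subseteq> D\<close> has_derivative_subset[OF _ \<open>U \<subseteq> D\<close>]
    unfolding holomorphic2_on_def by blast
  note coeffsU = coeffs[THEN onU]
  note lin = pd_linear_combination[OF \<open>open U\<close> _ _ _ _ pU]
  have y': "pd1 y p = - 1 / 3 * pd1 z p" "pd2 y p = - 1 / 3 * pd2 z p"
    unfolding y_def[abs_def] lin[OF holomorphic2_on_const hz holomorphic2_on_const hz] pd_const
    by simp_all
  have zy: "z p = - 3 * y p" by (simp add: y_def)
  have z11: "pd1 (pd1 z) p = pd1 (\<lambda>q. A q * y q + E q * y q) p"
    and z12: "pd1 (pd2 z) p = pd1 (\<lambda>q. C q * y q + H q * y q) p"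
    and z22: "pd2 (pd2 z) p = pd2 (\<lambda>q. C q * y q + H q * y q) p"
    using pd_cong[OF \<open>open U\<close> pU, of "pd1 z"] pd_cong[OF \<open>open U\<close> pU, of "pd2 z"] z1 z2 by simp_all
  have dP: "pd1 P1 p = 2 * pd1 E p - pd1 A p" "pd2 P1 p = 2 * pd2 E p - pd2 A p"
    "pd1 P2 p = 2 * pd1 C p - pd1 H p" "pd2 P2 p = 2 * pd2 C p - pd2 H p"
    unfolding P lin[OF holomorphic2_on_const coeffsU(4) holomorphic2_on_const coeffsU(1)]
      lin[OF holomorphic2_on_const coeffsU(3) holomorphic2_on_const coeffsU(6)] pd_const
    by simp_all
  have Pp: "P1 p = 2 * E p - A p" "P2 p = 2 * C p - H p" by (simp_all add: P)
  note I = integrability[OF sol p J[OF p]]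
  \<comment> \<open>The conditions are solved for derivatives that do not recur on the right. After
    the substitution, the remaining derivatives of the coefficients cancel, and what is left is a
    polynomial identity in the coefficients and \<open>y p\<close>.\<close>
  have I': "pd2 A p = pd1 C p + E p * C p - F1 p * F2 p"
    "pd2 F1 p = pd1 E p + C p * F1 p + E p * E p - A p * E p - F1 p * H p"
    "pd1 F2 p = pd2 C p + C p * C p + E p * F2 p - F2 p * A p - H p * C p"
    "pd1 H p = pd2 E p + C p * E p - F2 p * F1 p"
    using I by (simp_all add: algebra_simps)
  note lin' = lin[OF coeffsU(1) hy coeffsU(4) hy] lin[OF coeffsU(3) hy coeffsU(6) hy]
  note subst = z11 z12 z22 lin' y' z1[OF pU] z2[OF pU] zy dP Pp I'
  show "pd1 (pd1 z) p + 1/3 * P1 p * pd1 z p - F1 p * pd2 z p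
        + (pd2 F1 p - 1/3 * pd1 P1 p - 2/9 * (P1 p)\<^sup>2 - 2/3 * F1 p * P2 p) * z p = 0
    \<and> pd1 (pd2 z) p - 1/3 * P2 p * pd1 z p - 1/3 * P1 p * pd2 z p
        + (1/3 * pd1 P2 p + 1/3 * pd2 P1 p + 1/9 * P1 p * P2 p - F1 p * F2 p) * z p = 0
    \<and> pd2 (pd2 z) p + 1/3 * P2 p * pd2 z p - F2 p * pd1 z p
        + (pd1 F2 p - 1/3 * pd2 P2 p - 2/9 * (P2 p)\<^sup>2 - 2/3 * F2 p * P1 p) * z p = 0"
    by (intro conjI; simp add: subst; simp add: field_simps power2_eq_square)
qed

end
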